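(* Let $(M,g,e^{-f}dv_g)$ be a complete closed smooth metric measure space of dimension $n\ge 2$ satisfying ${\mathscr Ric}_f(g)\ge -\mathsf{k}\,g$ on $M$ with $\mathsf{k}\ge 0$. Let $\Sigma=\Sigma(u)$ be a sufficiently smooth function of one real variable and suppose $u$ is a bounded positive smooth solution of $\Delta_f u+\Sigma(u)=0$ on $M$ with $0<u\le A$ for a constant $A$. Assume moreover that along the solution $u$ we have $\Sigma(u)\ge 0$ and $\Sigma(u)/u-2\Sigma'(u)\ge 0$. Then $$|\nabla\log u|^2\le 2\mathsf{k}\,[1+\log(A/u)]\quad\text{on } M.$$ Furthermore, for every $\varepsilon>0$ and all $p,q\in M$, $$0<u(p)\le (eA)^{\varepsilon/(1+\varepsilon)}\,e^{\mathsf{k}d^2(p,q)/(2\varepsilon)}\,[u(q)]^{1/(1+\varepsilon)}.$$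
   Context: A smooth metric measure space $(M,g,e^{-f}dv_g)$ consists of a Riemannian manifold $(M,g)$, a smooth function (potential) $f$ on $M$, and the weighted measure $d\mu=e^{-f}dv_g$, with $dv_g$ the Riemannian volume measure; closed means that $M$ is compact without boundary. The $f$-Laplacian is $\Delta_f u=\Delta u-\langle\nabla f,\nabla u\rangle$, with $\Delta$ the Laplace-Beltrami operator. The generalised Ricci tensor is ${\mathscr Ric}_f(g)={\mathscr Ric}(g)+\mathrm{Hess}(f)$. $d(p,q)$ is the geodesic distance. *)

theory Defs
  imports "HOL-Analysis.Analysis"
begin

section \<open>Smooth maps and smooth manifolds\<close>

text \<open>Only meant for open \<open>S\<close>.\<close>

primrec higher_differentiable_on ::
  "('a::real_normed_vector \<Rightarrow> 'b::real_normed_vector) \<Rightarrow> 'a set \<Rightarrow> nat \<Rightarrow> bool" where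
  "higher_differentiable_on h S 0 \<longleftrightarrow> continuous_on S h"
| "higher_differentiable_on h S (Suc m) \<longleftrightarrow>
     (\<forall>x\<in>S. h differentiable (at x)) \<and>
     (\<forall>v. higher_differentiable_on (\<lambda>x. frechet_derivative h (at x) v) S m)"

definition smooth_on ::
  "('a::real_normed_vector \<Rightarrow> 'b::real_normed_vector) \<Rightarrow> 'a set \<Rightarrow> bool" where
  "smooth_on h S \<longleftrightarrow> (\<forall>m. higher_differentiable_on h S m)"

text \<open>A chart is a pair of its domain and its coordinate map; the values of the coordinate map
  outside the domain are irrelevant.  The dimension of the manifold is \<open>CARD('n)\<close>.\<close>

type_synonym ('a, 'n) chart = "'a set \<times> ('a \<Rightarrow> real ^ 'n)"

abbreviation chart_dom :: "('a, 'n) chart \<Rightarrow> 'a set" where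
  "chart_dom c \<equiv> fst c"

abbreviation chart_map :: "('a, 'n) chart \<Rightarrow> 'a \<Rightarrow> real ^ 'n" where
  "chart_map c \<equiv> snd c"

definition chart_inv :: "('a, 'n) chart \<Rightarrow> real ^ 'n \<Rightarrow> 'a" where
  "chart_inv c = inv_into (chart_dom c) (chart_map c)"

definition is_chart :: "'a topology \<Rightarrow> ('a, 'n::finite) chart \<Rightarrow> bool" where
  "is_chart M c \<longleftrightarrow>
     openin M (chart_dom c) \<and> open (chart_map c ` chart_dom c) \<and>
     homeomorphic_map (subtopology M (chart_dom c)) (top_of_set (chart_map c ` chart_dom c))
       (chart_map c)"

definition transition :: "('a, 'n) chart \<Rightarrow> ('a, 'n) chart \<Rightarrow> real ^ 'n \<Rightarrow> real ^ 'n" where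
  "transition c c' = chart_map c' \<circ> chart_inv c"

definition smooth_atlas :: "'a topology \<Rightarrow> ('a, 'n::finite) chart set \<Rightarrow> bool" where
  "smooth_atlas M \<A> \<longleftrightarrow>
     (\<forall>c\<in>\<A>. is_chart M c) \<and> (\<Union>c\<in>\<A>. chart_dom c) = topspace M \<and>
     (\<forall>c\<in>\<A>. \<forall>c'\<in>\<A>. smooth_on (transition c c') (chart_map c ` (chart_dom c \<inter> chart_dom c')))"

definition smooth_manifold :: "'a topology \<Rightarrow> ('a, 'n::finite) chart set \<Rightarrow> bool" where
  "smooth_manifold M \<A> \<longleftrightarrow> Hausdorff_space M \<and> second_countable M \<and> smooth_atlas M \<A>"

definition smooth_in_chart ::
  "('a, 'n::finite) chart \<Rightarrow> ('a \<Rightarrow> 'b::real_normed_vector) \<Rightarrow> bool" where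
  "smooth_in_chart c h \<longleftrightarrow> smooth_on (h \<circ> chart_inv c) (chart_map c ` chart_dom c)"

definition smooth_function :: "('a, 'n::finite) chart set \<Rightarrow> ('a \<Rightarrow> real) \<Rightarrow> bool" where
  "smooth_function \<A> h \<longleftrightarrow> (\<forall>c\<in>\<A>. smooth_in_chart c h)"


section \<open>Riemannian metrics\<close>

text \<open>Tensor fields are given by their components in every chart of the atlas, as functions of the
  point of the manifold.  For a metric \<open>g\<close>, \<open>g c p $ i $ j\<close> is the component
  \<open>g\<^sub>i\<^sub>j(p)\<close> in the chart \<open>c\<close> at the point \<open>p\<close> of its domain; the last clause is the transformation
  law of a tensor of type \<open>(0,2)\<close>.\<close>

type_synonym ('a, 'n) metric = "('a, 'n) chart \<Rightarrow> 'a \<Rightarrow> real ^ 'n ^ 'n"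

definition riemannian_metric :: "('a, 'n::finite) chart set \<Rightarrow> ('a, 'n) metric \<Rightarrow> bool" where
  "riemannian_metric \<A> g \<longleftrightarrow>
     (\<forall>c\<in>\<A>. smooth_in_chart c (g c)) \<and>
     (\<forall>c\<in>\<A>. \<forall>p\<in>chart_dom c.
        transpose (g c p) = g c p \<and> (\<forall>v. v \<noteq> 0 \<longrightarrow> v \<bullet> (g c p *v v) > 0)) \<and>
     (\<forall>c\<in>\<A>. \<forall>c'\<in>\<A>. \<forall>p\<in>chart_dom c \<inter> chart_dom c'.
        let J = jacobian (transition c c') (at (chart_map c p))
        in g c p = transpose J ** g c' p ** J)"

definition riemannian_manifold ::
  "'a topology \<Rightarrow> ('a, 'n::finite) chart set \<Rightarrow> ('a, 'n) metric \<Rightarrow> bool" where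
  "riemannian_manifold M \<A> g \<longleftrightarrow> smooth_manifold M \<A> \<and> riemannian_metric \<A> g"

text \<open>The weighted measure \<open>e\<^sup>-\<^sup>f dv\<^sub>g\<close> is determined by \<open>g\<close> and \<open>f\<close>.\<close>

definition smooth_metric_measure_space ::
  "'a topology \<Rightarrow> ('a, 'n::finite) chart set \<Rightarrow> ('a, 'n) metric \<Rightarrow> ('a \<Rightarrow> real) \<Rightarrow> bool" where
  "smooth_metric_measure_space M \<A> g f \<longleftrightarrow> riemannian_manifold M \<A> g \<and> smooth_function \<A> f"

definition metric_inner ::
  "('a, 'n::finite) metric \<Rightarrow> ('a, 'n) chart \<Rightarrow> 'a \<Rightarrow> real ^ 'n \<Rightarrow> real ^ 'n \<Rightarrow> real" where
  "metric_inner g c p v w = v \<bullet> (g c p *v w)"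

definition inverse_metric :: "('a, 'n::finite) metric \<Rightarrow> ('a, 'n) metric" where
  "inverse_metric g c p = matrix_inv (g c p)"


section \<open>Differential operators\<close>

text \<open>The partial derivative of \<open>h\<close> with respect to the \<open>i\<close>-th coordinate of the chart \<open>c\<close>, at the
  point \<open>p\<close>.\<close>

definition partial :: "('a, 'n::finite) chart \<Rightarrow> 'n \<Rightarrow> ('a \<Rightarrow> real) \<Rightarrow> 'a \<Rightarrow> real" where
  "partial c i h p = frechet_derivative (h \<circ> chart_inv c) (at (chart_map c p)) (axis i 1)"

definition gradient ::
  "('a, 'n::finite) metric \<Rightarrow> ('a, 'n) chart \<Rightarrow> ('a \<Rightarrow> real) \<Rightarrow> 'a \<Rightarrow> real ^ 'n" where
  "gradient g c h p = (\<chi> i. \<Sum>j\<in>UNIV. inverse_metric g c p $ i $ j * partial c j h p)"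

definition grad_norm_sq ::
  "('a, 'n::finite) metric \<Rightarrow> ('a, 'n) chart \<Rightarrow> ('a \<Rightarrow> real) \<Rightarrow> 'a \<Rightarrow> real" where
  "grad_norm_sq g c h p = metric_inner g c p (gradient g c h p) (gradient g c h p)"

definition divergence ::
  "('a, 'n::finite) metric \<Rightarrow> ('a, 'n) chart \<Rightarrow> ('a \<Rightarrow> real ^ 'n) \<Rightarrow> 'a \<Rightarrow> real" where
  "divergence g c X p =
     (\<Sum>i\<in>UNIV. partial c i (\<lambda>q. sqrt (det (g c q)) * X q $ i) p) / sqrt (det (g c p))"

definition laplace_beltrami ::
  "('a, 'n::finite) metric \<Rightarrow> ('a, 'n) chart \<Rightarrow> ('a \<Rightarrow> real) \<Rightarrow> 'a \<Rightarrow> real" where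
  "laplace_beltrami g c h p = divergence g c (gradient g c h) p"

definition f_laplacian ::
  "('a, 'n::finite) metric \<Rightarrow> ('a \<Rightarrow> real) \<Rightarrow> ('a, 'n) chart \<Rightarrow> ('a \<Rightarrow> real) \<Rightarrow> 'a \<Rightarrow> real" where
  "f_laplacian g f c h p =
     laplace_beltrami g c h p - metric_inner g c p (gradient g c f p) (gradient g c h p)"


section \<open>Curvature\<close>

text \<open>\<open>christoffel g c k i j\<close> is \<open>\<Gamma>\<^sup>k\<^sub>i\<^sub>j\<close>.\<close>

definition christoffel ::
  "('a, 'n::finite) metric \<Rightarrow> ('a, 'n) chart \<Rightarrow> 'n \<Rightarrow> 'n \<Rightarrow> 'n \<Rightarrow> 'a \<Rightarrow> real" where
  "christoffel g c k i j p =
     (\<Sum>l\<in>UNIV. inverse_metric g c p $ k $ l *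
        (partial c i (\<lambda>q. g c q $ j $ l) p + partial c j (\<lambda>q. g c q $ i $ l) p
         - partial c l (\<lambda>q. g c q $ i $ j) p)) / 2"

text \<open>\<open>riemann g c l i j k\<close> is the \<open>l\<close>-th component of \<open>R(\<partial>\<^sub>i, \<partial>\<^sub>j) \<partial>\<^sub>k\<close>, where
  \<open>R(X,Y)Z = \<nabla>\<^sub>X \<nabla>\<^sub>Y Z - \<nabla>\<^sub>Y \<nabla>\<^sub>X Z - \<nabla>\<^bsub>[X,Y]\<^esub> Z\<close>.  With this convention, and the contraction in
  \<open>ricci\<close>, round spheres have positive Ricci curvature.\<close>

definition riemann ::
  "('a, 'n::finite) metric \<Rightarrow> ('a, 'n) chart \<Rightarrow> 'n \<Rightarrow> 'n \<Rightarrow> 'n \<Rightarrow> 'n \<Rightarrow> 'a \<Rightarrow> real" where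
  "riemann g c l i j k p =
     partial c i (christoffel g c l j k) p - partial c j (christoffel g c l i k) p
     + (\<Sum>m\<in>UNIV. christoffel g c l i m p * christoffel g c m j k p
                 - christoffel g c l j m p * christoffel g c m i k p)"

definition ricci :: "('a, 'n::finite) metric \<Rightarrow> ('a, 'n) metric" where
  "ricci g c p = (\<chi> j k. \<Sum>i\<in>UNIV. riemann g c i i j k p)"

definition hessian ::
  "('a, 'n::finite) metric \<Rightarrow> ('a \<Rightarrow> real) \<Rightarrow> ('a, 'n) chart \<Rightarrow> 'a \<Rightarrow> real ^ 'n ^ 'n" where
  "hessian g h c p =
     (\<chi> i j. partial c i (partial c j h) p - (\<Sum>k\<in>UNIV. christoffel g c k i j p * partial c k h p))"

definition generalised_ricci ::
  "('a, 'n::finite) metric \<Rightarrow> ('a \<Rightarrow> real) \<Rightarrow> ('a, 'n) chart \<Rightarrow> 'a \<Rightarrow> real ^ 'n ^ 'n" where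
  "generalised_ricci g f c p = ricci g c p + hessian g f c p"

definition generalised_ricci_ge ::
  "('a, 'n::finite) chart set \<Rightarrow> ('a, 'n) metric \<Rightarrow> ('a \<Rightarrow> real) \<Rightarrow> real \<Rightarrow> bool" where
  "generalised_ricci_ge \<A> g f K \<longleftrightarrow>
     (\<forall>c\<in>\<A>. \<forall>p\<in>chart_dom c. \<forall>v. v \<bullet> (generalised_ricci g f c p *v v) \<ge> K * metric_inner g c p v v)"


section \<open>Geodesic distance\<close>

definition C1_curve_on ::
  "'a topology \<Rightarrow> ('a, 'n::finite) chart set \<Rightarrow> real \<Rightarrow> real \<Rightarrow> (real \<Rightarrow> 'a) \<Rightarrow> bool" where
  "C1_curve_on M \<A> a b \<gamma> \<longleftrightarrow>
     continuous_map (top_of_set {a..b}) M \<gamma> \<and>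
     (\<forall>c\<in>\<A>.
        (\<forall>t\<in>{t\<in>{a..b}. \<gamma> t \<in> chart_dom c}.
           (chart_map c \<circ> \<gamma>) differentiable (at t within {a..b})) \<and>
        continuous_on {t\<in>{a..b}. \<gamma> t \<in> chart_dom c}
          (\<lambda>t. vector_derivative (chart_map c \<circ> \<gamma>) (at t within {a..b})))"

text \<open>The finite set \<open>S\<close> consists of the points of a subdivision of \<open>{0..1}\<close> such that the curve is
  \<open>C\<^sup>1\<close> up to the boundary on each closed subinterval (so its velocity is bounded).\<close>

definition piecewise_C1_curve ::
  "'a topology \<Rightarrow> ('a, 'n::finite) chart set \<Rightarrow> (real \<Rightarrow> 'a) \<Rightarrow> bool" where
  "piecewise_C1_curve M \<A> \<gamma> \<longleftrightarrow>
     (\<exists>S. finite S \<and> {0, 1} \<subseteq> S \<and> S \<subseteq> {0..1} \<and>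
        (\<forall>a\<in>S. \<forall>b\<in>S. a < b \<and> {a<..<b} \<inter> S = {} \<longrightarrow> C1_curve_on M \<A> a b \<gamma>))"

text \<open>The speed does not depend on the chosen chart by the transformation law of the metric, and the
  finitely many parameters at which the curve is not differentiable do not affect its length.\<close>

definition speed ::
  "('a, 'n::finite) chart set \<Rightarrow> ('a, 'n) metric \<Rightarrow> (real \<Rightarrow> 'a) \<Rightarrow> real \<Rightarrow> real" where
  "speed \<A> g \<gamma> t =
     (let c = (SOME c. c \<in> \<A> \<and> \<gamma> t \<in> chart_dom c);
          v = vector_derivative (chart_map c \<circ> \<gamma>) (at t)
      in sqrt (metric_inner g c (\<gamma> t) v v))"

definition curve_length ::
  "('a, 'n::finite) chart set \<Rightarrow> ('a, 'n) metric \<Rightarrow> (real \<Rightarrow> 'a) \<Rightarrow> real" where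
  "curve_length \<A> g \<gamma> = integral {0..1} (speed \<A> g \<gamma>)"

text \<open>Only meaningful for points that can be joined by a curve, e.g. on a connected manifold.\<close>

definition geodesic_dist ::
  "'a topology \<Rightarrow> ('a, 'n::finite) chart set \<Rightarrow> ('a, 'n) metric \<Rightarrow> 'a \<Rightarrow> 'a \<Rightarrow> real" where
  "geodesic_dist M \<A> g p q =
     Inf {curve_length \<A> g \<gamma> | \<gamma>. piecewise_C1_curve M \<A> \<gamma> \<and> \<gamma> 0 = p \<and> \<gamma> 1 = q}"

end

theory Submission
  imports Defs
begin

text \<open>
  The equation and \<open>\<Sigma>(u) \<ge> 0\<close> give \<open>\<Delta>\<^sub>f u = - \<Sigma>(u) \<le> 0\<close>, so \<open>u\<close> is \<open>f\<close>-superharmonic.  On a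
  compact connected manifold without boundary such a function is constant
  (\<open>f_superharmonic_constant\<close>): it attains its minimum, and the strong minimum principle says that
  the set where it does so is open.  Being also closed and nonempty, this set is the whole manifold.

  For a constant \<open>u\<close> the gradient of \<open>log u\<close> vanishes, and the right-hand side of the gradient
  estimate is nonnegative because \<open>u \<le> A\<close> and \<open>k \<ge> 0\<close>.  The Harnack inequality becomes
  \<open>u \<le> (eA)\<^sup>s e\<^sup>t u\<^bsup>1-s\<^esup>\<close> with \<open>s = \<epsilon>/(1+\<epsilon>)\<close> and \<open>t \<ge> 0\<close>, which again is just \<open>u \<le> A\<close>
  (\<open>constant_harnack\<close>).

  The substance is the strong minimum principle, a local statement proved in a chart.  There
  \<open>\<Delta>\<^sub>f\<close> reads \<open>g\<^sup>i\<^sup>j \<partial>\<^sub>i \<partial>\<^sub>j + b\<^sup>j \<partial>\<^sub>j\<close> with continuous coefficients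
  (\<open>f_laplacian_eq_elliptic\<close>).  At an interior minimum such an operator is nonnegative
  (\<open>elliptic_nonneg_at_min\<close>, where the trace of a product of two positive forms enters through
  \<open>fejer_trace_nonneg\<close>).  If the minimum set of a supersolution were not open, some ball would touch
  it in exactly one point; subtracting a small multiple of Hopf's barrier
  \<open>exp (- \<alpha> |x - y|\<^sup>2)\<close> would then produce a strict supersolution with an interior minimum
  (\<open>no_isolated_touching_point\<close>), a contradiction.
\<close>

section \<open>Traces against positive forms\<close>

text \<open>Gaussian elimination on the positive form \<open>a\<close>: splitting off the rank-one form
  \<open>a\<^sub>i\<^sub>k a\<^sub>j\<^sub>k / a\<^sub>k\<^sub>k\<close> contributes the value of \<open>H\<close> at the \<open>k\<close>-th column of \<open>a\<close>, divided by
  \<open>a\<^sub>k\<^sub>k\<close>, and leaves a form (the Schur complement) that is positive on one coordinate fewer.  Only the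
  quadratic form of \<open>H\<close> enters, so the lemma applies directly to the matrix of iterated partial
  derivatives.\<close>

lemma fejer_trace_nonneg:
  fixes a H :: "'i \<Rightarrow> 'i \<Rightarrow> real"
  assumes "finite S"
    and "\<And>i j. a i j = a j i"
    and "\<And>v. (\<exists>i\<in>S. v i \<noteq> 0) \<Longrightarrow> (\<Sum>i\<in>S. \<Sum>j\<in>S. a i j * v i * v j) > 0"
    and "\<And>v. (\<Sum>i\<in>S. \<Sum>j\<in>S. H i j * v i * v j) \<ge> 0"
  shows "(\<Sum>i\<in>S. \<Sum>j\<in>S. a i j * H i j) \<ge> 0"
  using assms
proof (induction S arbitrary: a rule: finite_induct)
  case empty
  then show ?case by simp
next
  case (insert k S)
  have akk: "a k k > 0"
  proof -
    define e :: "'i \<Rightarrow> real" where "e i = (if i = k then 1 else 0)" for i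
    have "(\<Sum>i\<in>insert k S. \<Sum>j\<in>insert k S. a i j * e i * e j) > 0"
      by (rule insert.prems(2)) (auto simp: e_def)
    moreover have "e k = 1" "\<And>i. i \<in> S \<Longrightarrow> e i = 0"
      using insert.hyps by (auto simp: e_def)
    ultimately show ?thesis
      using insert.hyps by simp
  qed
  define a' where "a' i j = a i j - a i k * a j k / a k k" for i j
  have a'0: "a' i k = 0" "a' k i = 0" for i
    using akk insert.prems(1)[of k i] by (simp_all add: a'_def)
  have a'S: "(\<Sum>i\<in>insert k S. \<Sum>j\<in>insert k S. a' i j * X i j) = (\<Sum>i\<in>S. \<Sum>j\<in>S. a' i j * X i j)" for X
    using insert.hyps by (simp add: a'0)
  have split: "(\<Sum>i\<in>insert k S. \<Sum>j\<in>insert k S. a i j * X i j) =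
      (\<Sum>i\<in>S. \<Sum>j\<in>S. a' i j * X i j) +
      (\<Sum>i\<in>insert k S. \<Sum>j\<in>insert k S. X i j * a i k * a j k) / a k k" for X
    unfolding a'S[symmetric] sum_divide_distrib sum.distrib[symmetric]
    by (intro sum.cong refl) (simp add: a'_def field_simps)
  have "(\<Sum>i\<in>S. \<Sum>j\<in>S. a' i j * H i j) \<ge> 0"
  proof (rule insert.IH)
    show "a' i j = a' j i" for i j
      using insert.prems(1)[of i j] by (simp add: a'_def)
  next
    fix v :: "'i \<Rightarrow> real"
    assume v: "\<exists>i\<in>S. v i \<noteq> 0"
    \<comment> \<open>Completing the square: this value of the new coordinate makes the rank-one part vanish.\<close>
    define v' where "v' = v(k := - (\<Sum>i\<in>S. a i k * v i) / a k k)"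
    have "0 < (\<Sum>i\<in>insert k S. \<Sum>j\<in>insert k S. a i j * v' i * v' j)"
      using v insert.hyps by (intro insert.prems(2)) (auto simp: v'_def)
    also have "\<dots> = (\<Sum>i\<in>S. \<Sum>j\<in>S. a' i j * (v' i * v' j)) +
       (\<Sum>i\<in>insert k S. \<Sum>j\<in>insert k S. v' i * v' j * a i k * a j k) / a k k"
      unfolding split[of "\<lambda>i j. v' i * v' j", symmetric] by (simp add: mult.assoc)
    also have "(\<Sum>i\<in>insert k S. \<Sum>j\<in>insert k S. v' i * v' j * a i k * a j k) = (\<Sum>i\<in>insert k S. a i k * v' i)\<^sup>2"
      unfolding power2_eq_square sum_product by (simp add: mult_ac)
    also have "(\<Sum>i\<in>insert k S. a i k * v' i) = a k k * v' k + (\<Sum>i\<in>S. a i k * v' i)"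
      using insert.hyps by simp
    also have "(\<Sum>i\<in>S. a i k * v' i) = (\<Sum>i\<in>S. a i k * v i)"
      using insert.hyps by (intro sum.cong) (auto simp: v'_def)
    also have "a k k * v' k = - (\<Sum>i\<in>S. a i k * v i)"
      using akk by (simp add: v'_def)
    also have "(\<Sum>i\<in>S. \<Sum>j\<in>S. a' i j * (v' i * v' j)) = (\<Sum>i\<in>S. \<Sum>j\<in>S. a' i j * v i * v j)"
      using insert.hyps by (intro sum.cong refl) (auto simp: v'_def)
    finally show "0 < (\<Sum>i\<in>S. \<Sum>j\<in>S. a' i j * v i * v j)"
      by simp
  next
    fix v :: "'i \<Rightarrow> real"
    have "0 \<le> (\<Sum>i\<in>insert k S. \<Sum>j\<in>insert k S. H i j * (v(k := 0)) i * (v(k := 0)) j)"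
      by (rule insert.prems(3))
    also have "\<dots> = (\<Sum>i\<in>S. \<Sum>j\<in>S. H i j * (v(k := 0)) i * (v(k := 0)) j)"
      using insert.hyps by simp
    also have "\<dots> = (\<Sum>i\<in>S. \<Sum>j\<in>S. H i j * v i * v j)"
      using insert.hyps by (intro sum.cong refl) auto
    finally show "0 \<le> (\<Sum>i\<in>S. \<Sum>j\<in>S. H i j * v i * v j)" .
  qed
  moreover have "(\<Sum>i\<in>insert k S. \<Sum>j\<in>insert k S. H i j * a i k * a j k) \<ge> 0"
    by (rule insert.prems(3))
  ultimately show ?case
    unfolding split using akk by simp
qed

section \<open>The strong minimum principle in Euclidean space\<close>

text \<open>First and second derivatives are carried as explicit functions \<open>D j = \<partial>\<^sub>j w\<close> and
  \<open>H i j = \<partial>\<^sub>i \<partial>\<^sub>j w\<close>, so that subtracting a barrier acts on them componentwise.\<close>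

definition C2_data ::
  "(real ^ 'n) set \<Rightarrow> (real ^ 'n \<Rightarrow> real) \<Rightarrow> ('n \<Rightarrow> real ^ 'n \<Rightarrow> real) \<Rightarrow>
    ('n \<Rightarrow> 'n \<Rightarrow> real ^ 'n \<Rightarrow> real) \<Rightarrow> bool" where
  "C2_data U w D H \<longleftrightarrow>
     (\<forall>x\<in>U. (w has_derivative (\<lambda>v. \<Sum>j\<in>UNIV. D j x * v $ j)) (at x) \<and>
        (\<forall>j. (D j has_derivative (\<lambda>v. \<Sum>i\<in>UNIV. H i j x * v $ i)) (at x)))"

definition elliptic ::
  "('n::finite \<Rightarrow> 'n \<Rightarrow> real ^ 'n \<Rightarrow> real) \<Rightarrow> ('n \<Rightarrow> real ^ 'n \<Rightarrow> real) \<Rightarrow>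
    ('n \<Rightarrow> real ^ 'n \<Rightarrow> real) \<Rightarrow> ('n \<Rightarrow> 'n \<Rightarrow> real ^ 'n \<Rightarrow> real) \<Rightarrow> real ^ 'n \<Rightarrow> real" where
  "elliptic a b D H x =
     (\<Sum>i\<in>UNIV. \<Sum>j\<in>UNIV. a i j x * H i j x) + (\<Sum>j\<in>UNIV. b j x * D j x)"

lemma sum_mult_axis: "(\<Sum>j\<in>UNIV. d j * axis i 1 $ j) = (d i :: real)"
  by (simp add: axis_def if_distrib cong: if_cong)

text \<open>The first and second derivative tests.  The second one reduces to the line \<open>x + t v\<close>: a negative
  second derivative at \<open>0\<close> would make the first derivative negative just to the right of \<open>0\<close>.\<close>

lemma C2_data_min:
  fixes w :: "real ^ 'n \<Rightarrow> real"
  assumes C2: "C2_data U w D H" and U: "open U" and x: "x \<in> U"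
    and min: "\<And>y. y \<in> U \<Longrightarrow> w x \<le> w y"
  shows "D j x = 0" and "(\<Sum>i\<in>UNIV. \<Sum>j\<in>UNIV. H i j x * v $ i * v $ j) \<ge> 0"
proof -
  have D: "(w has_derivative (\<lambda>v. \<Sum>j\<in>UNIV. D j y * v $ j)) (at y)" if "y \<in> U" for y
    using C2 that by (simp add: C2_data_def)
  have H: "(D j has_derivative (\<lambda>v. \<Sum>i\<in>UNIV. H i j x * v $ i)) (at x)" for j
    using C2 x by (simp add: C2_data_def)
  have "(\<lambda>v. \<Sum>j\<in>UNIV. D j x * v $ j) = (\<lambda>v. 0)"
    using min by (intro differential_zero_maxmin[OF x U D[OF x]]) auto
  from fun_cong[OF this] have D0: "D j x = 0" for j
    using sum_mult_axis[of "\<lambda>j. D j x" j] by metis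
  then show "D j x = 0" .
  define \<phi> where "\<phi> t = w (x + t *\<^sub>R v)" for t
  define \<phi>' where "\<phi>' t = (\<Sum>j\<in>UNIV. D j (x + t *\<^sub>R v) * v $ j)" for t
  have "open ((\<lambda>t. x + t *\<^sub>R v) -` U)"
    by (intro continuous_open_vimage U) (auto intro!: continuous_intros)
  moreover have "0 \<in> (\<lambda>t. x + t *\<^sub>R v) -` U"
    using x by simp
  ultimately obtain e where e0: "e > 0" "ball 0 e \<subseteq> (\<lambda>t. x + t *\<^sub>R v) -` U"
    by (rule openE)
  have e: "x + t *\<^sub>R v \<in> U" if "\<bar>t\<bar> < e" for t
    using subsetD[OF e0(2), of t] that by simp
  have \<phi>: "(\<phi> has_real_derivative \<phi>' t) (at t)" if "\<bar>t\<bar> < e" for t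
  proof -
    have "((\<lambda>t. x + t *\<^sub>R v) has_derivative (\<lambda>s. s *\<^sub>R v)) (at t)"
      by (auto intro!: derivative_eq_intros)
    from has_derivative_compose[OF this D[OF e[OF that]]]
    have "(\<phi> has_derivative (\<lambda>s. \<Sum>j\<in>UNIV. D j (x + t *\<^sub>R v) * (s *\<^sub>R v) $ j)) (at t)"
      by (simp add: \<phi>_def[abs_def])
    moreover have "(\<lambda>s. \<Sum>j\<in>UNIV. D j (x + t *\<^sub>R v) * (s *\<^sub>R v) $ j) = (*) (\<phi>' t)"
      by (auto simp: fun_eq_iff \<phi>'_def sum_distrib_left sum_distrib_right mult_ac)
    ultimately show ?thesis
      by (simp add: has_field_derivative_def)
  qed
  have \<phi>'': "(\<phi>' has_real_derivative (\<Sum>i\<in>UNIV. \<Sum>j\<in>UNIV. H i j x * v $ i * v $ j)) (at 0)"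
  proof -
    have l: "((\<lambda>t. x + t *\<^sub>R v) has_derivative (\<lambda>s. s *\<^sub>R v)) (at 0)"
      by (auto intro!: derivative_eq_intros)
    have "((\<lambda>t. D j (x + t *\<^sub>R v)) has_derivative (\<lambda>s. \<Sum>i\<in>UNIV. H i j x * (s *\<^sub>R v) $ i)) (at 0)" for j
    proof -
      have "(D j has_derivative (\<lambda>v. \<Sum>i\<in>UNIV. H i j x * v $ i)) (at (x + 0 *\<^sub>R v))"
        using H by simp
      from has_derivative_compose[OF l this] show ?thesis .
    qed
    then have "(\<phi>' has_derivative (\<lambda>s. \<Sum>j\<in>UNIV. (\<Sum>i\<in>UNIV. H i j x * (s *\<^sub>R v) $ i) * v $ j)) (at 0)"
      unfolding \<phi>'_def[abs_def] by (intro has_derivative_sum has_derivative_mult_left)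
    moreover have "(\<Sum>j\<in>UNIV. (\<Sum>i\<in>UNIV. H i j x * (s *\<^sub>R v) $ i) * v $ j) =
        (\<Sum>i\<in>UNIV. \<Sum>j\<in>UNIV. H i j x * v $ i * v $ j) * s" for s
      by (subst sum.swap[of "\<lambda>i j. H i j x * v $ i * v $ j"])
        (simp add: sum_distrib_left sum_distrib_right mult_ac)
    ultimately show ?thesis
      by (simp add: has_field_derivative_def)
  qed
  show "(\<Sum>i\<in>UNIV. \<Sum>j\<in>UNIV. H i j x * v $ i * v $ j) \<ge> 0"
  proof (rule ccontr)
    assume "\<not> ?thesis"
    then obtain d where d: "d > 0" "\<And>h. 0 < h \<Longrightarrow> h < d \<Longrightarrow> \<phi>' (0 + h) < \<phi>' 0"
      using DERIV_neg_dec_right[OF \<phi>''] by auto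
    define t where "t = min d e / 2"
    have t: "0 < t" "t < d" "t < e" using d e0(1) by (auto simp: t_def)
    obtain s where s: "0 < s" "s < t" "\<phi> t - \<phi> 0 = (t - 0) * \<phi>' s"
      using MVT2[of 0 t \<phi> \<phi>'] \<phi> t by auto
    have "\<phi>' s < 0"
      using d(2)[of s] s t D0 by (simp add: \<phi>'_def)
    then have "\<phi> t < \<phi> 0"
      using s t by (smt (verit) mult_pos_neg)
    then show False
      using min[OF e[of t]] t by (simp add: \<phi>_def)
  qed
qed

lemma elliptic_nonneg_at_min:
  fixes w :: "real ^ 'n \<Rightarrow> real"
  assumes C2: "C2_data U w D H" and U: "open U" and x: "x \<in> U"
    and min: "\<And>y. y \<in> U \<Longrightarrow> w x \<le> w y"
    and sym: "\<And>i j. a i j x = a j i x"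
    and pos: "\<And>v. v \<noteq> 0 \<Longrightarrow> (\<Sum>i\<in>UNIV. \<Sum>j\<in>UNIV. a i j x * v $ i * v $ j) > 0"
  shows "elliptic a b D H x \<ge> 0"
proof -
  have "(\<Sum>i\<in>UNIV. \<Sum>j\<in>UNIV. a i j x * H i j x) \<ge> 0"
  proof (rule fejer_trace_nonneg[OF finite sym])
    fix v :: "'n \<Rightarrow> real"
    assume "\<exists>i\<in>UNIV. v i \<noteq> 0"
    then have "(\<chi> i. v i) \<noteq> 0" by (auto simp: vec_eq_iff)
    from pos[OF this] show "0 < (\<Sum>i\<in>UNIV. \<Sum>j\<in>UNIV. a i j x * v i * v j)" by simp
  next
    fix v :: "'n \<Rightarrow> real"
    from C2_data_min(2)[OF C2 U x min, of "\<chi> i. v i"]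
    show "0 \<le> (\<Sum>i\<in>UNIV. \<Sum>j\<in>UNIV. H i j x * v i * v j)" by simp
  qed
  then show ?thesis
    using C2_data_min(1)[OF C2 U x min] by (simp add: elliptic_def)
qed

lemma C2_data_diff_scale:
  assumes "C2_data U w D H" "C2_data U h D' H'"
  shows "C2_data U (\<lambda>x. w x - \<epsilon> * h x) (\<lambda>j x. D j x - \<epsilon> * D' j x) (\<lambda>i j x. H i j x - \<epsilon> * H' i j x)"
proof -
  have *: "((\<lambda>x. w x - \<epsilon> * h x) has_derivative (\<lambda>v. \<Sum>j\<in>UNIV. (d j - \<epsilon> * d' j) * v $ j)) (at x)"
    if "(w has_derivative (\<lambda>v. \<Sum>j\<in>UNIV. d j * v $ j)) (at x)"
      "(h has_derivative (\<lambda>v. \<Sum>j\<in>UNIV. d' j * v $ j)) (at x)"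
    for w h :: "real ^ 'a \<Rightarrow> real" and d d' x
    using has_derivative_diff[OF that(1) has_derivative_mult_right[OF that(2)], of \<epsilon>]
    by (simp add: sum_distrib_left sum_subtractf left_diff_distrib mult.assoc)
  show ?thesis
    unfolding C2_data_def
  proof (intro ballI conjI allI)
    fix x j assume "x \<in> U"
    with assms show "((\<lambda>x. w x - \<epsilon> * h x) has_derivative
        (\<lambda>v. \<Sum>j\<in>UNIV. (D j x - \<epsilon> * D' j x) * v $ j)) (at x)"
      and "((\<lambda>x. D j x - \<epsilon> * D' j x) has_derivative
        (\<lambda>v. \<Sum>i\<in>UNIV. (H i j x - \<epsilon> * H' i j x) * v $ i)) (at x)"
      by (simp_all add: C2_data_def *)
  qed
qed

lemma elliptic_diff_scale:
  "elliptic a b (\<lambda>j x. D j x - \<epsilon> * D' j x) (\<lambda>i j x. H i j x - \<epsilon> * H' i j x) x =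
     elliptic a b D H x - \<epsilon> * elliptic a b D' H' x"
  by (simp add: elliptic_def sum_distrib_left sum_subtractf right_diff_distrib distrib_left mult_ac)

text \<open>Hopf's barrier.  The second derivative in the radial direction carries the factor \<open>\<alpha>\<^sup>2\<close>, all other
  contributions to an elliptic operator only \<open>\<alpha>\<close>; a large \<open>\<alpha>\<close> thus makes it a strict subsolution
  near any point other than \<open>y\<close>.\<close>

definition barrier :: "real \<Rightarrow> real ^ 'n \<Rightarrow> real ^ 'n \<Rightarrow> real" where
  "barrier \<alpha> y x = exp (- \<alpha> * (norm (x - y))\<^sup>2)"

lemma barrier_C2_data:
  "C2_data U (barrier \<alpha> y) (\<lambda>j x. - 2 * \<alpha> * (x - y) $ j * barrier \<alpha> y x)
     (\<lambda>i j x. (4 * \<alpha>\<^sup>2 * (x - y) $ i * (x - y) $ j - (if i = j then 2 * \<alpha> else 0)) * barrier \<alpha> y x)"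
proof -
  have 1: "(barrier \<alpha> y has_derivative
      (\<lambda>v. \<Sum>j\<in>UNIV. - 2 * \<alpha> * (x - y) $ j * barrier \<alpha> y x * v $ j)) (at x)" for x
  proof -
    have "(barrier \<alpha> y has_derivative (\<lambda>v. - 2 * \<alpha> * ((x - y) \<bullet> v) * barrier \<alpha> y x)) (at x)"
      unfolding barrier_def[abs_def] power2_norm_eq_inner
      by (auto intro!: derivative_eq_intros simp: inner_commute algebra_simps)
    then show ?thesis
      by (simp add: inner_vec_def sum_distrib_left sum_distrib_right mult_ac)
  qed
  have "((\<lambda>x. - 2 * \<alpha> * (x - y) $ j * barrier \<alpha> y x) has_derivative
     (\<lambda>v. \<Sum>i\<in>UNIV. (4 * \<alpha>\<^sup>2 * (x - y) $ i * (x - y) $ j - (if i = j then 2 * \<alpha> else 0)) *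
        barrier \<alpha> y x * v $ i)) (at x)" for x j
  proof -
    have c: "((\<lambda>x. - 2 * \<alpha> * (x - y) $ j) has_derivative (\<lambda>v. - 2 * \<alpha> * v $ j)) (at x)"
      by (auto intro!: derivative_eq_intros bounded_linear.has_derivative[OF bounded_linear_vec_nth])
    have "(\<lambda>v. - 2 * \<alpha> * (x - y) $ j * (\<Sum>j\<in>UNIV. - 2 * \<alpha> * (x - y) $ j * barrier \<alpha> y x * v $ j) +
        - 2 * \<alpha> * v $ j * barrier \<alpha> y x) =
      (\<lambda>v. \<Sum>i\<in>UNIV. (4 * \<alpha>\<^sup>2 * (x - y) $ i * (x - y) $ j - (if i = j then 2 * \<alpha> else 0)) *
        barrier \<alpha> y x * v $ i)"
    proof
      fix v :: "real ^ 'a"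
      define d where "d = x - y"
      define B where "B = barrier \<alpha> y x"
      have "(\<Sum>i\<in>UNIV. (if i = j then 2 * \<alpha> else 0) * B * v $ i) = 2 * \<alpha> * B * v $ j"
        by (simp add: if_distrib[of "\<lambda>t. t * _"] cong: if_cong)
      then have "(\<Sum>i\<in>UNIV. (4 * \<alpha>\<^sup>2 * d $ i * d $ j - (if i = j then 2 * \<alpha> else 0)) * B * v $ i) =
          (\<Sum>i\<in>UNIV. 4 * \<alpha>\<^sup>2 * d $ i * d $ j * B * v $ i) - 2 * \<alpha> * B * v $ j"
        by (simp only: left_diff_distrib sum_subtractf)
      then show "- 2 * \<alpha> * (x - y) $ j * (\<Sum>j\<in>UNIV. - 2 * \<alpha> * (x - y) $ j * barrier \<alpha> y x * v $ j) +
        - 2 * \<alpha> * v $ j * barrier \<alpha> y x =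
        (\<Sum>i\<in>UNIV. (4 * \<alpha>\<^sup>2 * (x - y) $ i * (x - y) $ j - (if i = j then 2 * \<alpha> else 0)) *
        barrier \<alpha> y x * v $ i)"
        unfolding d_def[symmetric] B_def[symmetric]
        by (simp add: sum_distrib_left power2_eq_square mult_ac)
    qed
    with has_derivative_mult[OF c 1] show ?thesis
      by simp
  qed
  with 1 show ?thesis by (simp add: C2_data_def)
qed

lemma elliptic_barrier:
  "elliptic a b (\<lambda>j x. - 2 * \<alpha> * (x - y) $ j * barrier \<alpha> y x)
     (\<lambda>i j x. (4 * \<alpha>\<^sup>2 * (x - y) $ i * (x - y) $ j - (if i = j then 2 * \<alpha> else 0)) * barrier \<alpha> y x) x =
   (4 * \<alpha>\<^sup>2 * (\<Sum>i\<in>UNIV. \<Sum>j\<in>UNIV. a i j x * (x - y) $ i * (x - y) $ j)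
     - 2 * \<alpha> * ((\<Sum>i\<in>UNIV. a i i x) + (\<Sum>j\<in>UNIV. b j x * (x - y) $ j))) * barrier \<alpha> y x"
proof -
  have "(\<Sum>i\<in>UNIV. \<Sum>j\<in>UNIV. a i j x * ((if i = j then 2 * \<alpha> else 0) * barrier \<alpha> y x)) =
      2 * \<alpha> * (\<Sum>i\<in>UNIV. a i i x) * barrier \<alpha> y x"
    by (simp add: if_distrib[of "\<lambda>t. t * _"] if_distrib[of "\<lambda>t. _ * t"] sum_distrib_left sum_distrib_right mult_ac cong: if_cong)
  then show ?thesis
    unfolding elliptic_def left_diff_distrib right_diff_distrib sum_subtractf
    by (simp add: sum_distrib_left sum_distrib_right distrib_left left_diff_distrib sum_negf mult_ac)
qed

text \<open>In Hopf's lemma one compares on an annulus and looks at the normal derivative at the touching point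
  \<open>z\<close>.  Since the closed ball around \<open>y\<close> meets the minimum set in \<open>z\<close> only, a full ball around \<open>z\<close>
  serves instead.  On the part of its boundary sphere inside the ball around \<open>y\<close>, \<open>w\<close> exceeds its
  minimum by some \<open>\<delta>\<close>; on the rest, the barrier is at most its value at \<open>z\<close>.  Subtracting \<open>\<delta>\<close>
  times the barrier hence keeps the boundary values above the value at \<open>z\<close>, which forces an
  interior minimum where the operator is negative.\<close>

lemma no_isolated_touching_point:
  fixes w :: "real ^ 'n \<Rightarrow> real"
  assumes C2: "C2_data U w D H" and U: "open U"
    and acont: "\<And>i j. continuous_on U (a i j)" and bcont: "\<And>j. continuous_on U (b j)"
    and sym: "\<And>i j x. x \<in> U \<Longrightarrow> a i j x = a j i x"
    and pos: "\<And>x v. x \<in> U \<Longrightarrow> v \<noteq> 0 \<Longrightarrow> (\<Sum>i\<in>UNIV. \<Sum>j\<in>UNIV. a i j x * v $ i * v $ j) > 0"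
    and super: "\<And>x. x \<in> U \<Longrightarrow> elliptic a b D H x \<le> 0"
    and ge: "\<And>x. x \<in> U \<Longrightarrow> m \<le> w x"
    and z: "z \<in> U" "w z = m" "z \<noteq> y" "dist y z = R"
    and touch: "\<And>x. x \<in> U \<Longrightarrow> dist y x \<le> R \<Longrightarrow> x \<noteq> z \<Longrightarrow> m < w x"
  shows False
proof -
  define P where "P x = (\<Sum>i\<in>UNIV. \<Sum>j\<in>UNIV. a i j x * (x - y) $ i * (x - y) $ j)" for x
  define Q where "Q x = (\<Sum>i\<in>UNIV. a i i x) + (\<Sum>j\<in>UNIV. b j x * (x - y) $ j)" for x
  have Pz: "P z > 0"
    unfolding P_def using z by (intro pos) auto
  \<comment> \<open>With \<open>L\<close> as below, this choice gives \<open>L z = 2 \<alpha> (2 (\<bar>Q z\<bar> + 1) - Q z) > 0\<close>.\<close>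
  define \<alpha> where "\<alpha> = (\<bar>Q z\<bar> + 1) / P z"
  have \<alpha>: "\<alpha> > 0" unfolding \<alpha>_def using Pz by (intro divide_pos_pos) auto
  define L where "L x = 4 * \<alpha>\<^sup>2 * P x - 2 * \<alpha> * Q x" for x
  have "L z = 2 * \<alpha> * (2 * (\<alpha> * P z) - Q z)"
    by (simp add: L_def power2_eq_square algebra_simps)
  also have "\<alpha> * P z = \<bar>Q z\<bar> + 1"
    using Pz by (simp add: \<alpha>_def)
  finally have Lz: "L z > 0"
    using \<alpha> by simp
  have "continuous_on U L"
    unfolding L_def P_def Q_def by (intro continuous_intros acont bcont)
  then have "open (L -` {0<..} \<inter> U)"
    using U by (simp add: continuous_open_preimage Int_commute)
  then obtain r where r: "r > 0" "cball z r \<subseteq> L -` {0<..} \<inter> U"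
    using Lz z by (metis IntI greaterThan_iff open_contains_cball vimageI)
  have wcont: "continuous_on U w"
    using C2 by (auto simp: C2_data_def intro!: continuous_at_imp_continuous_on has_derivative_continuous)
  define K where "K = sphere z r \<inter> cball y R"
  have KU: "K \<subseteq> U" using r by (auto simp: K_def)
  have Kpos: "m < w x" if "x \<in> K" for x
    using that KU r by (intro touch) (auto simp: K_def)
  have "\<exists>\<delta>>0. \<forall>x\<in>K. m + \<delta> \<le> w x"
  proof (cases "K = {}")
    case True
    then show ?thesis by (auto intro: exI[of _ 1])
  next
    case False
    have "compact K" by (simp add: K_def compact_Int)
    from continuous_attains_inf[OF this False continuous_on_subset[OF wcont KU]]
    obtain x where "x \<in> K" "\<forall>x'\<in>K. w x \<le> w x'" by blast
    then show ?thesis using Kpos by (intro exI[of _ "w x - m"]) auto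
  qed
  then obtain \<delta> where \<delta>: "\<delta> > 0" "\<And>x. x \<in> K \<Longrightarrow> m + \<delta> \<le> w x" by blast
  let ?D = "\<lambda>j x. - 2 * \<alpha> * (x - y) $ j * barrier \<alpha> y x"
  let ?H = "\<lambda>i j x. (4 * \<alpha>\<^sup>2 * (x - y) $ i * (x - y) $ j - (if i = j then 2 * \<alpha> else 0)) * barrier \<alpha> y x"
  define W where "W x = w x - \<delta> * barrier \<alpha> y x" for x
  have WC2: "C2_data U W (\<lambda>j x. D j x - \<delta> * ?D j x) (\<lambda>i j x. H i j x - \<delta> * ?H i j x)"
    unfolding W_def[abs_def] by (rule C2_data_diff_scale[OF C2 barrier_C2_data])
  have Lneg: "elliptic a b (\<lambda>j x. D j x - \<delta> * ?D j x) (\<lambda>i j x. H i j x - \<delta> * ?H i j x) x < 0"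
    if "x \<in> cball z r" for x
  proof -
    have "L x > 0" "x \<in> U" using r that by auto
    moreover have "barrier \<alpha> y x > 0" by (simp add: barrier_def)
    ultimately have "\<delta> * (L x * barrier \<alpha> y x) > 0" using \<delta> by simp
    with super[OF \<open>x \<in> U\<close>] show ?thesis
      unfolding elliptic_diff_scale elliptic_barrier
      unfolding P_def[symmetric] Q_def[symmetric] L_def[symmetric] by linarith
  qed
  have Wsphere: "W z \<le> W x" if x: "x \<in> sphere z r" for x
  proof (cases "dist y x \<le> R")
    case True
    then have "m + \<delta> \<le> w x" using x \<delta>(2)[of x] by (simp add: K_def)
    moreover have "barrier \<alpha> y x \<le> 1" using \<alpha> by (simp add: barrier_def)
    then have "\<delta> * barrier \<alpha> y x \<le> \<delta>" using \<delta>(1) by simp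
    moreover have "\<delta> * barrier \<alpha> y z \<ge> 0" using \<delta>(1) by (simp add: barrier_def)
    ultimately show ?thesis using z by (simp add: W_def)
  next
    case False
    then have "norm (z - y) \<le> norm (x - y)" using z by (simp add: dist_norm norm_minus_commute)
    then have "barrier \<alpha> y x \<le> barrier \<alpha> y z"
      using \<alpha> by (simp add: barrier_def power_mono)
    then have "\<delta> * barrier \<alpha> y x \<le> \<delta> * barrier \<alpha> y z" using \<delta>(1) by simp
    moreover have "m \<le> w x" using x r by (intro ge) auto
    ultimately show ?thesis using z by (simp add: W_def)
  qed
  have "continuous_on (cball z r) W"
    unfolding W_def barrier_def using r
    by (auto intro!: continuous_intros continuous_on_subset[OF wcont])
  from continuous_attains_inf[OF compact_cball _ this]
  obtain x0 where x0: "x0 \<in> cball z r" "\<And>x. x \<in> cball z r \<Longrightarrow> W x0 \<le> W x"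
    using r(1) by auto
  \<comment> \<open>If the minimum is only known to be attained on the sphere, then \<open>z\<close> attains it too.\<close>
  obtain x1 where x1: "x1 \<in> ball z r" "\<And>x. x \<in> ball z r \<Longrightarrow> W x1 \<le> W x"
  proof (cases "x0 \<in> ball z r")
    case True
    then show ?thesis using x0 that by auto
  next
    case False
    then have "W z \<le> W x0" using x0(1) by (intro Wsphere) auto
    then show ?thesis
      using x0(2) r(1) by (intro that[of z]) (auto intro: order_trans[OF _ x0(2)])
  qed
  have sub: "C2_data (ball z r) W (\<lambda>j x. D j x - \<delta> * ?D j x) (\<lambda>i j x. H i j x - \<delta> * ?H i j x)"
    using WC2 r(2) by (auto simp: C2_data_def subset_iff)
  have x1U: "x1 \<in> U" using x1 r by auto
  have "elliptic a b (\<lambda>j x. D j x - \<delta> * ?D j x) (\<lambda>i j x. H i j x - \<delta> * ?H i j x) x1 \<ge> 0"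
    by (rule elliptic_nonneg_at_min[OF sub open_ball x1(1)]) (use x1(2) sym[OF x1U] pos[OF x1U] in auto)
  with Lneg[of x1] x1(1) show False by simp
qed

text \<open>Near a boundary point of the minimum set, take a ball outside the set that reaches its nearest
  point \<open>z\<close>.  The ball of half the radius, internally tangent at \<open>z\<close>, has \<open>z\<close> as its only point of
  contact.\<close>

lemma strong_minimum_principle:
  fixes w :: "real ^ 'n \<Rightarrow> real"
  assumes C2: "C2_data U w D H" and U: "open U"
    and acont: "\<And>i j. continuous_on U (a i j)" and bcont: "\<And>j. continuous_on U (b j)"
    and sym: "\<And>i j x. x \<in> U \<Longrightarrow> a i j x = a j i x"
    and pos: "\<And>x v. x \<in> U \<Longrightarrow> v \<noteq> 0 \<Longrightarrow> (\<Sum>i\<in>UNIV. \<Sum>j\<in>UNIV. a i j x * v $ i * v $ j) > 0"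
    and super: "\<And>x. x \<in> U \<Longrightarrow> elliptic a b D H x \<le> 0"
    and ge: "\<And>x. x \<in> U \<Longrightarrow> m \<le> w x"
  shows "open {x \<in> U. w x = m}"
  unfolding open_contains_ball
proof
  fix x0 assume x0: "x0 \<in> {x \<in> U. w x = m}"
  then obtain e where e: "e > 0" "cball x0 e \<subseteq> U"
    using U by (auto simp: open_contains_cball)
  have wcont: "continuous_on U w"
    using C2 by (auto simp: C2_data_def intro!: continuous_at_imp_continuous_on has_derivative_continuous)
  have "y \<in> {x \<in> U. w x = m}" if y: "y \<in> ball x0 (e / 2)" for y
  proof (rule ccontr)
    have yU: "y \<in> U" using y e by (force simp: subset_iff)
    assume "y \<notin> {x \<in> U. w x = m}"
    with yU have wy: "w y \<noteq> m" by simp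
    define K where "K = {x \<in> cball x0 e. w x = m}"
    have "closed K"
      unfolding K_def using continuous_on_subset[OF wcont e(2)]
      by (intro continuous_closed_preimage_constant) auto
    moreover have x0K: "x0 \<in> K" using x0 e by (simp add: K_def)
    ultimately obtain z where z: "z \<in> K" "\<And>x. x \<in> K \<Longrightarrow> dist y z \<le> dist y x"
      using distance_attains_inf[of K y] by blast
    have zy: "z \<noteq> y" using z(1) wy by (auto simp: K_def)
    define c where "c = midpoint y z"
    have cz: "dist c z = dist y z / 2" "dist y c = dist y z / 2"
      by (simp_all add: c_def dist_midpoint)
    show False
    proof (rule no_isolated_touching_point[OF C2 U acont bcont sym pos super ge, of z c "dist y z / 2"])
      show "z \<in> U" "w z = m" using z(1) e(2) by (auto simp: K_def)
      show "z \<noteq> c" using zy cz(1) by auto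
      show "dist c z = dist y z / 2" by (rule cz)
      fix x assume x: "x \<in> U" "dist c x \<le> dist y z / 2" "x \<noteq> z"
      have "w x \<noteq> m"
      proof
        assume wx: "w x = m"
        have yx: "dist y x \<le> dist y z"
          using dist_triangle[of y x c] x(2) cz(2) by simp
        also have "\<dots> \<le> dist y x0" by (rule z(2)[OF x0K])
        finally have "dist x0 x \<le> e"
          using dist_triangle[of x0 x y] y by (simp add: dist_commute)
        then have "x \<in> K" using wx by (simp add: K_def)
        then have eq: "dist y x = dist y z" using z(2) yx by (simp add: order_antisym)
        \<comment> \<open>By the parallelogram identity, \<open>z\<close> is the only point of the half-size ball at the full
          distance from \<open>y\<close>.\<close>
        define s where "s = z - c"
        define t where "t = x - c"
        have yc: "y = c - s"
          unfolding s_def c_def midpoint_def by (simp add: algebra_simps flip: scaleR_2)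
        have "norm s = dist y z / 2" using cz(1) by (simp add: s_def dist_norm norm_minus_commute)
        moreover have "norm t \<le> dist y z / 2" using x(2) by (simp add: t_def dist_norm norm_minus_commute)
        moreover have "norm (t + s) = dist y z"
          using eq by (simp add: yc t_def dist_norm norm_minus_commute algebra_simps)
        ultimately have n: "norm t \<le> norm s" "norm (t + s) = 2 * norm s" by auto
        have "(norm (t - s))\<^sup>2 + (norm (t + s))\<^sup>2 = 2 * (norm t)\<^sup>2 + 2 * (norm s)\<^sup>2"
          by (simp add: power2_norm_eq_inner algebra_simps inner_commute)
        moreover have "(norm t)\<^sup>2 \<le> (norm s)\<^sup>2" using n by (simp add: power_mono)
        moreover have "(norm (t + s))\<^sup>2 = 4 * (norm s)\<^sup>2" using n by (simp add: power_mult_distrib)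
        ultimately have "(norm (t - s))\<^sup>2 \<le> 0" by linarith
        then have "x = z" by (simp add: s_def t_def)
        with x(3) show False by simp
      qed
      with ge[OF x(1)] show "m < w x" by simp
    qed
  qed
  with e(1) show "\<exists>e>0. ball x0 e \<subseteq> {x \<in> U. w x = m}"
    by (intro exI[of _ "e / 2"]) auto
qed

section \<open>Continuously differentiable coefficients\<close>

text \<open>The chart expression of \<open>\<Delta>\<^sub>f\<close> contains derivatives of \<open>sqrt (det g)\<close> times the inverse metric.
  One continuous derivative of these coefficients is what the drift term needs.\<close>

definition C1_on :: "'a::real_normed_vector set \<Rightarrow> ('a \<Rightarrow> real) \<Rightarrow> bool" where
  "C1_on S h \<longleftrightarrow>
     (\<exists>D. (\<forall>x\<in>S. (h has_derivative D x) (at x)) \<and> (\<forall>v. continuous_on S (\<lambda>x. D x v)))"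

lemma C1_onI:
  assumes "\<And>x. x \<in> S \<Longrightarrow> (h has_derivative D x) (at x)" "\<And>v. continuous_on S (\<lambda>x. D x v)"
  shows "C1_on S h"
  using assms by (auto simp: C1_on_def)

lemma C1_onE:
  assumes "C1_on S h"
  obtains D where "\<And>x. x \<in> S \<Longrightarrow> (h has_derivative D x) (at x)" "\<And>v. continuous_on S (\<lambda>x. D x v)"
  using assms by (auto simp: C1_on_def)

lemma C1_on_imp_continuous_on: "C1_on S h \<Longrightarrow> continuous_on S h"
  by (metis C1_onE continuous_at_imp_continuous_on has_derivative_continuous)

lemma C1_on_has_derivative:
  "C1_on S h \<Longrightarrow> x \<in> S \<Longrightarrow> (h has_derivative frechet_derivative h (at x)) (at x)"
  by (metis C1_onE differentiableI frechet_derivative_works)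

lemma C1_on_continuous_derivative:
  assumes "C1_on S h"
  shows "continuous_on S (\<lambda>x. frechet_derivative h (at x) v)"
proof -
  obtain D where D: "\<And>x. x \<in> S \<Longrightarrow> (h has_derivative D x) (at x)" "\<And>v. continuous_on S (\<lambda>x. D x v)"
    using assms by (rule C1_onE) blast
  have "frechet_derivative h (at x) v = D x v" if "x \<in> S" for x
    using frechet_derivative_at[OF D(1)[OF that]] by simp
  with D(2)[of v] show ?thesis
    by (simp cong: continuous_on_cong)
qed

lemma C1_on_cong:
  assumes "C1_on S h" "open S" "\<And>x. x \<in> S \<Longrightarrow> h x = h' x"
  shows "C1_on S h'"
proof -
  obtain D where D: "\<And>x. x \<in> S \<Longrightarrow> (h has_derivative D x) (at x)" "\<And>v. continuous_on S (\<lambda>x. D x v)"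
    using assms(1) by (rule C1_onE) blast
  show ?thesis
    by (rule C1_onI[OF has_derivative_transform_within_open[OF D(1) assms(2)] D(2)]) (use assms(3) in auto)
qed

lemma C1_on_const: "C1_on S (\<lambda>x. k)"
  by (rule C1_onI[of _ _ "\<lambda>_ _. 0"]) auto

lemma C1_on_mult:
  assumes "C1_on S f" "C1_on S h"
  shows "C1_on S (\<lambda>x. f x * h x)"
proof -
  obtain D where D: "\<And>x. x \<in> S \<Longrightarrow> (f has_derivative D x) (at x)" "\<And>v. continuous_on S (\<lambda>x. D x v)"
    using assms(1) by (rule C1_onE) blast
  obtain E where E: "\<And>x. x \<in> S \<Longrightarrow> (h has_derivative E x) (at x)" "\<And>v. continuous_on S (\<lambda>x. E x v)"
    using assms(2) by (rule C1_onE) blast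
  show ?thesis
  proof (rule C1_onI)
    show "((\<lambda>x. f x * h x) has_derivative (\<lambda>v. f x * E x v + D x v * h x)) (at x)" if "x \<in> S" for x
      using that by (intro has_derivative_mult D(1) E(1))
    show "continuous_on S (\<lambda>x. f x * E x v + D x v * h x)" for v
      by (intro continuous_intros D(2) E(2) C1_on_imp_continuous_on assms)
  qed
qed

lemma C1_on_sum:
  assumes "\<And>i. i \<in> I \<Longrightarrow> C1_on S (f i)"
  shows "C1_on S (\<lambda>x. \<Sum>i\<in>I. f i x)"
proof -
  have "\<forall>i\<in>I. \<exists>D. (\<forall>x\<in>S. (f i has_derivative D x) (at x)) \<and> (\<forall>v. continuous_on S (\<lambda>x. D x v))"
    using assms by (auto simp: C1_on_def)
  then obtain D where "\<And>i x. i \<in> I \<Longrightarrow> x \<in> S \<Longrightarrow> (f i has_derivative D i x) (at x)"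
    "\<And>i v. i \<in> I \<Longrightarrow> continuous_on S (\<lambda>x. D i x v)"
    by metis
  then show ?thesis
    by (intro C1_onI[of _ _ "\<lambda>x v. \<Sum>i\<in>I. D i x v"]) (auto intro!: has_derivative_sum continuous_on_sum)
qed

lemma C1_on_prod:
  assumes "\<And>i. i \<in> I \<Longrightarrow> C1_on S (f i)"
  shows "C1_on S (\<lambda>x. \<Prod>i\<in>I. f i x)"
  using assms by (induction I rule: infinite_finite_induct) (auto intro: C1_on_const C1_on_mult)

lemma C1_on_compose_real:
  fixes \<phi> :: "real \<Rightarrow> real"
  assumes "C1_on S h" "\<And>t. t \<noteq> 0 \<Longrightarrow> (\<phi> has_real_derivative \<phi>' t) (at t)"
    "continuous_on (- {0}) \<phi>'" "\<And>x. x \<in> S \<Longrightarrow> h x \<noteq> 0"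
  shows "C1_on S (\<lambda>x. \<phi> (h x))"
proof -
  obtain D where D: "\<And>x. x \<in> S \<Longrightarrow> (h has_derivative D x) (at x)" "\<And>v. continuous_on S (\<lambda>x. D x v)"
    using assms(1) by (rule C1_onE) blast
  show ?thesis
  proof (rule C1_onI)
    fix x assume x: "x \<in> S"
    show "((\<lambda>x. \<phi> (h x)) has_derivative (\<lambda>v. \<phi>' (h x) * D x v)) (at x)"
      using has_derivative_compose[OF D(1)[OF x] assms(2)[OF assms(4)[OF x], unfolded has_field_derivative_def]] .
  next
    show "continuous_on S (\<lambda>x. \<phi>' (h x) * D x v)" for v
      using assms(4)
      by (intro continuous_intros D(2) continuous_on_compose2[OF assms(3)] C1_on_imp_continuous_on assms(1)) auto
  qed
qed

lemma C1_on_inverse: "C1_on S h \<Longrightarrow> (\<And>x. x \<in> S \<Longrightarrow> h x \<noteq> 0) \<Longrightarrow> C1_on S (\<lambda>x. inverse (h x))"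
  by (rule C1_on_compose_real[where \<phi>' = "\<lambda>t. - (inverse t * inverse t)"])
    (auto intro!: derivative_eq_intros continuous_intros)

text \<open>The function \<open>sqrt\<close> is odd on the reals, hence continuously differentiable at negative
  numbers as well.  For the density of the metric it thus suffices to know that the determinant does
  not vanish.\<close>

lemma C1_on_sqrt:
  assumes "C1_on S h" "\<And>x. x \<in> S \<Longrightarrow> h x \<noteq> 0"
  shows "C1_on S (\<lambda>x. sqrt (h x))"
proof (rule C1_on_compose_real[OF assms(1) _ _ assms(2)])
  show "(sqrt has_real_derivative inverse (sqrt \<bar>t\<bar>) / 2) (at t)" if "t \<noteq> 0" for t
    using that by (intro DERIV_real_sqrt_generic) (auto simp: real_sqrt_minus)
  show "continuous_on (- {0}) (\<lambda>t. inverse (sqrt \<bar>t\<bar>) / 2)"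
    by (intro continuous_intros) auto
qed

lemma C1_on_det:
  fixes A :: "'a::real_normed_vector \<Rightarrow> real ^ 'n ^ 'n"
  assumes "\<And>i j. C1_on S (\<lambda>x. A x $ i $ j)"
  shows "C1_on S (\<lambda>x. det (A x))"
  unfolding det_def by (intro C1_on_sum C1_on_mult C1_on_const C1_on_prod assms)

section \<open>Inverses of positive matrices\<close>

lemma matrix_inv_mult:
  fixes A :: "real ^ 'n ^ 'n"
  assumes "det A \<noteq> 0"
  shows "A ** matrix_inv A = mat 1" "matrix_inv A ** A = mat 1"
proof -
  have "\<exists>B. A ** B = mat 1 \<and> B ** A = mat 1"
    using assms by (simp add: invertible_det_nz[symmetric] invertible_def)
  from someI_ex[OF this] show "A ** matrix_inv A = mat 1" "matrix_inv A ** A = mat 1"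
    by (simp_all add: matrix_inv_def)
qed

text \<open>This writes an entry of the inverse as a rational function of the entries of \<open>A\<close>, from which its
  differentiability is read off.\<close>

lemma matrix_inv_cramer:
  fixes A :: "real ^ 'n ^ 'n"
  assumes "det A \<noteq> 0"
  shows "matrix_inv A $ k $ l = det (\<chi> i j. if j = k then axis l 1 $ i else A $ i $ j) * inverse (det A)"
proof -
  have "A *v (matrix_inv A *v axis l 1) = axis l 1"
    by (simp add: matrix_vector_mul_assoc matrix_inv_mult[OF assms])
  from arg_cong[OF iffD1[OF cramer[OF assms] this], of "\<lambda>x. x $ k"]
  have "(matrix_inv A *v axis l 1) $ k = det (\<chi> i j. if j = k then axis l 1 $ i else A $ i $ j) / det A"
    by (simp only: vec_lambda_beta)
  moreover have "(matrix_inv A *v axis l 1) $ k = matrix_inv A $ k $ l"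
    by (simp add: matrix_vector_mult_basis column_def)
  ultimately show ?thesis
    by (simp only: divide_inverse)
qed

lemma C1_on_matrix_inv:
  fixes A :: "'a::real_normed_vector \<Rightarrow> real ^ 'n ^ 'n"
  assumes A: "\<And>i j. C1_on S (\<lambda>x. A x $ i $ j)" and S: "open S" and nz: "\<And>x. x \<in> S \<Longrightarrow> det (A x) \<noteq> 0"
  shows "C1_on S (\<lambda>x. matrix_inv (A x) $ k $ l)"
proof -
  have "C1_on S (\<lambda>x. (\<chi> i j. if j = k then axis l 1 $ i else A x $ i $ j) $ i $ j)" for i j
    using A by (cases "j = k") (simp_all add: C1_on_const)
  then have "C1_on S (\<lambda>x. det (\<chi> i j. if j = k then axis l 1 $ i else A x $ i $ j) * inverse (det (A x)))"
    by (intro C1_on_mult C1_on_inverse C1_on_det A nz)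
  then show ?thesis
    by (rule C1_on_cong[OF _ S]) (rule matrix_inv_cramer[OF nz, symmetric])
qed

lemma positive_matrix_det_nz:
  fixes A :: "real ^ 'n ^ 'n"
  assumes "\<And>v. v \<noteq> 0 \<Longrightarrow> v \<bullet> (A *v v) > 0"
  shows "det A \<noteq> 0"
proof -
  have "\<exists>B. B ** A = mat 1"
    unfolding matrix_left_invertible_ker by (metis assms inner_zero_right less_irrefl)
  then show ?thesis
    by (metis invertible_det_nz invertible_left_inverse)
qed

text \<open>With \<open>v = A w\<close>, the value of the inverse form at \<open>v\<close> is the value of the form of \<open>A\<close> at \<open>w\<close>.\<close>

lemma positive_matrix_inv:
  fixes A :: "real ^ 'n ^ 'n"
  assumes "\<And>v. v \<noteq> 0 \<Longrightarrow> v \<bullet> (A *v v) > 0" "v \<noteq> 0"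
  shows "v \<bullet> (matrix_inv A *v v) > 0"
proof -
  define w where "w = matrix_inv A *v v"
  have v: "A *v w = v"
    unfolding w_def matrix_vector_mul_assoc
    by (simp add: matrix_inv_mult positive_matrix_det_nz[OF assms(1)])
  with assms(2) have "w \<noteq> 0" by auto
  from assms(1)[OF this] show ?thesis
    by (simp add: v w_def[symmetric] inner_commute)
qed

lemma symmetric_matrix_inv:
  fixes A :: "real ^ 'n ^ 'n"
  assumes "det A \<noteq> 0" "transpose A = A"
  shows "transpose (matrix_inv A) = matrix_inv A"
proof -
  have "transpose (matrix_inv A) ** A = mat 1"
    by (metis assms matrix_inv_mult(1) matrix_transpose_mul transpose_mat)
  then have "transpose (matrix_inv A) ** (A ** matrix_inv A) = matrix_inv A"
    by (simp add: matrix_mul_assoc)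
  then show ?thesis
    by (simp add: matrix_inv_mult[OF assms(1)])
qed

section \<open>Smooth functions in a chart\<close>

lemma smooth_on_differentiable:
  "smooth_on h S \<Longrightarrow> x \<in> S \<Longrightarrow> (h has_derivative frechet_derivative h (at x)) (at x)"
  unfolding smooth_on_def by (metis frechet_derivative_works higher_differentiable_on.simps(2))

lemma smooth_on_directional_derivative:
  "smooth_on h S \<Longrightarrow> smooth_on (\<lambda>x. frechet_derivative h (at x) v) S"
  unfolding smooth_on_def by (metis higher_differentiable_on.simps(2))

lemma smooth_on_imp_continuous_on: "smooth_on h S \<Longrightarrow> continuous_on S h"
  unfolding smooth_on_def by (metis higher_differentiable_on.simps(1))

lemma smooth_on_bounded_linear_C1_on:
  assumes "smooth_on h S" "bounded_linear L"
  shows "C1_on S (\<lambda>x. L (h x))"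
proof (rule C1_onI)
  show "((\<lambda>x. L (h x)) has_derivative (\<lambda>v. L (frechet_derivative h (at x) v))) (at x)" if "x \<in> S" for x
    by (rule bounded_linear.has_derivative[OF assms(2) smooth_on_differentiable[OF assms(1) that]])
  show "continuous_on S (\<lambda>x. L (frechet_derivative h (at x) v))" for v
    by (intro bounded_linear.continuous_on[OF assms(2)] smooth_on_imp_continuous_on
        smooth_on_directional_derivative assms(1))
qed

text \<open>Passes from an abstract derivative to the coordinate form used in \<open>C2_data\<close>.\<close>

lemma derivative_coordinates:
  fixes F :: "real ^ 'n \<Rightarrow> real"
  assumes "(h has_derivative F) (at x)"
  shows "(h has_derivative (\<lambda>v. \<Sum>i\<in>UNIV. F (axis i 1) * v $ i)) (at x)"
proof -
  have F: "linear F" using assms by (rule has_derivative_linear)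
  have "F = (\<lambda>v. \<Sum>i\<in>UNIV. F (axis i 1) * v $ i)"
  proof
    fix v :: "real ^ 'n"
    have "v = (\<Sum>i\<in>UNIV. v $ i *\<^sub>R axis i 1)"
      by (simp add: basis_expansion scalar_mult_eq_scaleR[symmetric])
    then have "F v = F (\<Sum>i\<in>UNIV. v $ i *\<^sub>R axis i 1)" by (rule arg_cong)
    also have "\<dots> = (\<Sum>i\<in>UNIV. F (axis i 1) * v $ i)"
      by (simp add: linear_sum[OF F] linear_cmul[OF F] mult.commute)
    finally show "F v = (\<Sum>i\<in>UNIV. F (axis i 1) * v $ i)" .
  qed
  with assms show ?thesis by metis
qed

definition coord_deriv :: "'n::finite \<Rightarrow> (real ^ 'n \<Rightarrow> real) \<Rightarrow> real ^ 'n \<Rightarrow> real" where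
  "coord_deriv i w x = frechet_derivative w (at x) (axis i 1)"

lemma smooth_on_C2_data:
  fixes w :: "real ^ 'n \<Rightarrow> real"
  assumes "smooth_on w U"
  shows "C2_data U w (\<lambda>j. coord_deriv j w) (\<lambda>i j. coord_deriv i (coord_deriv j w))"
  unfolding C2_data_def coord_deriv_def[abs_def]
  by (auto intro!: derivative_coordinates smooth_on_differentiable smooth_on_directional_derivative assms)

lemma coord_deriv_mult_sum:
  assumes "\<And>j. (P j has_derivative frechet_derivative (P j) (at x)) (at x)"
    and "\<And>j. (Q j has_derivative frechet_derivative (Q j) (at x)) (at x)"
    and S: "open S" "x \<in> S" "\<And>y. y \<in> S \<Longrightarrow> h y = (\<Sum>j\<in>UNIV. P j y * Q j y)"
  shows "coord_deriv i h x = (\<Sum>j\<in>UNIV. P j x * coord_deriv i (Q j) x + coord_deriv i (P j) x * Q j x)"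
proof -
  have "((\<lambda>y. \<Sum>j\<in>UNIV. P j y * Q j y) has_derivative
      (\<lambda>v. \<Sum>j\<in>UNIV. P j x * frechet_derivative (Q j) (at x) v + frechet_derivative (P j) (at x) v * Q j x)) (at x)"
    by (intro has_derivative_sum has_derivative_mult assms)
  then have "(h has_derivative
      (\<lambda>v. \<Sum>j\<in>UNIV. P j x * frechet_derivative (Q j) (at x) v + frechet_derivative (P j) (at x) v * Q j x)) (at x)"
    by (rule has_derivative_transform_within_open[OF _ S(1,2)]) (simp add: S(3))
  from frechet_derivative_at[OF this, symmetric] show ?thesis
    by (simp add: coord_deriv_def)
qed

text \<open>Everything local happens in the coordinate image of one chart; the topology of the manifold
  and the other charts enter only when the local results are glued together.\<close>

locale riemannian_chart =
  fixes c :: "('a, 'n::finite) chart" and g :: "('a, 'n) metric"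
  assumes inj_chart: "inj_on (chart_map c) (chart_dom c)"
    and open_image: "open (chart_map c ` chart_dom c)"
    and metric_smooth: "smooth_in_chart c (g c)"
    and metric_sym: "\<And>p. p \<in> chart_dom c \<Longrightarrow> transpose (g c p) = g c p"
    and metric_pos: "\<And>p v. p \<in> chart_dom c \<Longrightarrow> v \<noteq> 0 \<Longrightarrow> v \<bullet> (g c p *v v) > 0"
begin

abbreviation U :: "(real ^ 'n) set" where "U \<equiv> chart_map c ` chart_dom c"

abbreviation G :: "real ^ 'n \<Rightarrow> real ^ 'n ^ 'n" where "G x \<equiv> g c (chart_inv c x)"

lemma chart_inv_in: "x \<in> U \<Longrightarrow> chart_inv c x \<in> chart_dom c"
  by (simp add: chart_inv_def inv_into_into)

lemma chart_map_inv: "x \<in> U \<Longrightarrow> chart_map c (chart_inv c x) = x"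
  by (simp add: chart_inv_def f_inv_into_f)

lemma chart_inv_map: "p \<in> chart_dom c \<Longrightarrow> chart_inv c (chart_map c p) = p"
  by (simp add: chart_inv_def inj_chart)

lemma partial_eq: "x \<in> U \<Longrightarrow> partial c i h (chart_inv c x) = coord_deriv i (h \<circ> chart_inv c) x"
  by (simp add: partial_def coord_deriv_def chart_map_inv)

lemma det_G: "x \<in> U \<Longrightarrow> det (G x) \<noteq> 0"
  by (intro positive_matrix_det_nz metric_pos chart_inv_in)

lemma G_C1: "C1_on U (\<lambda>x. G x $ i $ j)"
proof -
  have "bounded_linear (\<lambda>B :: real ^ 'n ^ 'n. B $ i $ j)"
    using bounded_linear_compose[OF bounded_linear_vec_nth bounded_linear_vec_nth] .
  from smooth_on_bounded_linear_C1_on[OF metric_smooth[unfolded smooth_in_chart_def] this]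
  show ?thesis by simp
qed

lemma inv_G_C1: "C1_on U (\<lambda>x. matrix_inv (G x) $ i $ j)"
  by (intro C1_on_matrix_inv G_C1 open_image det_G)

text \<open>The coefficients of the Laplace-Beltrami operator in divergence form,
  \<open>\<Delta> u = (det g)\<^bsup>-1/2\<^esup> \<partial>\<^sub>i ((det g)\<^bsup>1/2\<^esup> g\<^sup>i\<^sup>j \<partial>\<^sub>j u)\<close>.\<close>

definition density_inv :: "'n \<Rightarrow> 'n \<Rightarrow> real ^ 'n \<Rightarrow> real" where
  "density_inv i j x = sqrt (det (G x)) * matrix_inv (G x) $ i $ j"

lemma density_inv_C1: "C1_on U (density_inv i j)"
  unfolding density_inv_def[abs_def]
  by (intro C1_on_mult C1_on_sqrt C1_on_det G_C1 inv_G_C1 det_G)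

text \<open>The first-order coefficients of \<open>\<Delta>\<^sub>f\<close>: differentiating the coefficients of the divergence form
  gives the sum, and \<open>\<langle>\<nabla>f, \<nabla>u\<rangle>\<close> gives the components of the gradient of \<open>f\<close>.\<close>

definition drift :: "('a \<Rightarrow> real) \<Rightarrow> 'n \<Rightarrow> real ^ 'n \<Rightarrow> real" where
  "drift f j x =
     (\<Sum>i\<in>UNIV. coord_deriv i (density_inv i j) x) / sqrt (det (G x)) - gradient g c f (chart_inv c x) $ j"

lemma gradient_eq:
  "x \<in> U \<Longrightarrow> gradient g c h (chart_inv c x) $ i =
     (\<Sum>j\<in>UNIV. matrix_inv (G x) $ i $ j * coord_deriv j (h \<circ> chart_inv c) x)"
  by (simp add: gradient_def inverse_metric_def partial_eq)

lemma drift_continuous: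
  assumes "smooth_in_chart c f"
  shows "continuous_on U (drift f j)"
proof -
  have grad: "continuous_on U (\<lambda>x. gradient g c f (chart_inv c x) $ j)"
  proof (subst continuous_on_cong[OF refl gradient_eq])
    show "continuous_on U (\<lambda>x. \<Sum>k\<in>UNIV. matrix_inv (G x) $ j $ k * coord_deriv k (f \<circ> chart_inv c) x)"
      unfolding coord_deriv_def
      by (intro continuous_intros C1_on_imp_continuous_on[OF inv_G_C1] smooth_on_imp_continuous_on
          smooth_on_directional_derivative assms[unfolded smooth_in_chart_def])
  qed
  have density: "continuous_on U (\<lambda>x. sqrt (det (G x)))"
    by (intro C1_on_imp_continuous_on C1_on_sqrt C1_on_det G_C1 det_G)
  show ?thesis
    unfolding drift_def coord_deriv_def
    by (intro continuous_on_diff continuous_on_divide continuous_on_sum C1_on_continuous_derivative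
        density_inv_C1 grad density) (use det_G in auto)
qed

text \<open>The product rule applied to the divergence form, together with
  \<open>\<langle>\<nabla>f, \<nabla>u\<rangle> = (\<nabla>f)\<^sup>j \<partial>\<^sub>j u\<close>, where the metric cancels against its inverse.\<close>

lemma f_laplacian_eq_elliptic:
  assumes u: "smooth_in_chart c u" and x: "x \<in> U"
  defines "w \<equiv> u \<circ> chart_inv c"
  shows "f_laplacian g f c u (chart_inv c x) =
    elliptic (\<lambda>i j x. matrix_inv (G x) $ i $ j) (drift f)
      (\<lambda>j. coord_deriv j w) (\<lambda>i j. coord_deriv i (coord_deriv j w)) x"
proof -
  let ?s = "sqrt (det (G x))"
  have s: "?s \<noteq> 0" using det_G[OF x] by simp
  have w: "smooth_on w U" using u by (simp add: w_def smooth_in_chart_def)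
  have "partial c i (\<lambda>q. sqrt (det (g c q)) * gradient g c u q $ i) (chart_inv c x) =
      (\<Sum>j\<in>UNIV. density_inv i j x * coord_deriv i (coord_deriv j w) x +
        coord_deriv i (density_inv i j) x * coord_deriv j w x)" for i
    unfolding partial_eq[OF x]
  proof (rule coord_deriv_mult_sum[OF _ _ open_image x])
    show "(density_inv i j has_derivative frechet_derivative (density_inv i j) (at x)) (at x)" for j
      by (rule C1_on_has_derivative[OF density_inv_C1 x])
    show "(coord_deriv j w has_derivative frechet_derivative (coord_deriv j w) (at x)) (at x)" for j
      unfolding coord_deriv_def[abs_def]
      by (rule smooth_on_differentiable[OF smooth_on_directional_derivative[OF w] x])
    show "((\<lambda>q. sqrt (det (g c q)) * gradient g c u q $ i) \<circ> chart_inv c) y =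
        (\<Sum>j\<in>UNIV. density_inv i j y * coord_deriv j w y)" if "y \<in> U" for y
      using that by (simp add: gradient_eq density_inv_def w_def sum_distrib_left mult.assoc)
  qed
  then have "laplace_beltrami g c u (chart_inv c x) =
      (\<Sum>i\<in>UNIV. \<Sum>j\<in>UNIV. density_inv i j x * coord_deriv i (coord_deriv j w) x) / ?s +
      (\<Sum>i\<in>UNIV. \<Sum>j\<in>UNIV. coord_deriv i (density_inv i j) x * coord_deriv j w x) / ?s"
    by (simp add: laplace_beltrami_def divergence_def sum.distrib add_divide_distrib)
  also have "(\<Sum>i\<in>UNIV. \<Sum>j\<in>UNIV. density_inv i j x * coord_deriv i (coord_deriv j w) x) / ?s =
      (\<Sum>i\<in>UNIV. \<Sum>j\<in>UNIV. matrix_inv (G x) $ i $ j * coord_deriv i (coord_deriv j w) x)"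
    using s by (simp add: sum_divide_distrib density_inv_def)
  also have "(\<Sum>i\<in>UNIV. \<Sum>j\<in>UNIV. coord_deriv i (density_inv i j) x * coord_deriv j w x) / ?s =
      (\<Sum>j\<in>UNIV. (\<Sum>i\<in>UNIV. coord_deriv i (density_inv i j) x) / ?s * coord_deriv j w x)"
    by (subst sum.swap) (simp add: sum_divide_distrib sum_distrib_right)
  finally have L: "laplace_beltrami g c u (chart_inv c x) =
      (\<Sum>i\<in>UNIV. \<Sum>j\<in>UNIV. matrix_inv (G x) $ i $ j * coord_deriv i (coord_deriv j w) x) +
      (\<Sum>j\<in>UNIV. (\<Sum>i\<in>UNIV. coord_deriv i (density_inv i j) x) / ?s * coord_deriv j w x)" .
  have "gradient g c u (chart_inv c x) = matrix_inv (G x) *v (\<chi> j. coord_deriv j w x)"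
    using x by (simp add: vec_eq_iff gradient_eq matrix_vector_mult_def w_def)
  then have "g c (chart_inv c x) *v gradient g c u (chart_inv c x) = (\<chi> j. coord_deriv j w x)"
    by (simp add: matrix_vector_mul_assoc matrix_inv_mult det_G[OF x])
  then have "metric_inner g c (chart_inv c x) (gradient g c f (chart_inv c x)) (gradient g c u (chart_inv c x)) =
      (\<Sum>j\<in>UNIV. gradient g c f (chart_inv c x) $ j * coord_deriv j w x)"
    by (simp add: metric_inner_def inner_vec_def)
  with L show ?thesis
    by (simp add: f_laplacian_def elliptic_def drift_def left_diff_distrib sum_subtractf)
qed

lemma minimum_set_open:
  assumes f: "smooth_in_chart c f" and u: "smooth_in_chart c u"
    and super: "\<And>p. p \<in> chart_dom c \<Longrightarrow> f_laplacian g f c u p \<le> 0"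
    and ge: "\<And>p. p \<in> chart_dom c \<Longrightarrow> m \<le> u p"
  shows "open {x \<in> U. (u \<circ> chart_inv c) x = m}"
proof (rule strong_minimum_principle[OF smooth_on_C2_data open_image C1_on_imp_continuous_on[OF inv_G_C1]
        drift_continuous[OF f]])
  show "smooth_on (u \<circ> chart_inv c) U" using u by (simp add: smooth_in_chart_def)
next
  fix i j x assume x: "x \<in> U"
  have "transpose (matrix_inv (G x)) = matrix_inv (G x)"
    by (intro symmetric_matrix_inv det_G metric_sym chart_inv_in x)
  then show "matrix_inv (G x) $ i $ j = matrix_inv (G x) $ j $ i"
    by (metis transpose_def vec_lambda_beta)
next
  fix x v :: "real ^ 'n" assume x: "x \<in> U" and v: "v \<noteq> 0"
  have "v \<bullet> (matrix_inv (G x) *v v) > 0"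
    by (intro positive_matrix_inv metric_pos chart_inv_in x v)
  then show "(\<Sum>i\<in>UNIV. \<Sum>j\<in>UNIV. matrix_inv (G x) $ i $ j * v $ i * v $ j) > 0"
    by (simp add: inner_vec_def matrix_vector_mult_def sum_distrib_left mult_ac)
next
  fix x assume x: "x \<in> U"
  show "elliptic (\<lambda>i j x. matrix_inv (G x) $ i $ j) (drift f) (\<lambda>j. coord_deriv j (u \<circ> chart_inv c))
      (\<lambda>i j. coord_deriv i (coord_deriv j (u \<circ> chart_inv c))) x \<le> 0"
    using super[OF chart_inv_in[OF x]] by (simp add: f_laplacian_eq_elliptic[OF u x])
  show "m \<le> (u \<circ> chart_inv c) x"
    using ge[OF chart_inv_in[OF x]] by simp
qed

end

section \<open>Superharmonic functions on a closed manifold\<close>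

lemma is_chart_imp_inj: "is_chart M c \<Longrightarrow> inj_on (chart_map c) (chart_dom c)"
  unfolding is_chart_def
  by (metis homeomorphic_imp_injective_map openin_subset topspace_subtopology_subset)

lemma openin_chart_preimage:
  assumes "is_chart M c" "open W"
  shows "openin M {p \<in> chart_dom c. chart_map c p \<in> W}"
proof -
  let ?U = "chart_map c ` chart_dom c"
  have dom: "openin M (chart_dom c)" and hom: "homeomorphic_map (subtopology M (chart_dom c)) (top_of_set ?U) (chart_map c)"
    using assms(1) by (auto simp: is_chart_def)
  have top: "topspace (subtopology M (chart_dom c)) = chart_dom c"
    using openin_subset[OF dom] by auto
  have "openin (top_of_set ?U) (?U \<inter> W)"
    using assms(2) by (rule openin_open_Int)
  from openin_continuous_map_preimage[OF homeomorphic_imp_continuous_map[OF hom] this]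
  have "openin (subtopology M (chart_dom c)) {p \<in> chart_dom c. chart_map c p \<in> ?U \<inter> W}"
    by (simp only: top)
  moreover have "{p \<in> chart_dom c. chart_map c p \<in> ?U \<inter> W} = {p \<in> chart_dom c. chart_map c p \<in> W}"
    by auto
  ultimately show ?thesis
    using dom by (metis openin_trans_full)
qed

lemma openin_charts:
  assumes "smooth_atlas M \<A>" "S \<subseteq> topspace M"
    and "\<And>c. c \<in> \<A> \<Longrightarrow> openin M (chart_dom c \<inter> S)"
  shows "openin M S"
proof -
  have "S = (\<Union>c\<in>\<A>. chart_dom c \<inter> S)"
    using assms(1,2) by (auto simp: smooth_atlas_def)
  then show ?thesis
    using assms(3) by (metis (no_types, lifting) imageE openin_Union)
qed

lemma smooth_function_continuous:
  assumes atlas: "smooth_atlas M \<A>" and u: "smooth_function \<A> u"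
  shows "continuous_map M euclideanreal u"
  unfolding continuous_map_def
proof (intro conjI allI impI)
  fix V :: "real set" assume V: "openin euclideanreal V"
  show "openin M {p \<in> topspace M. u p \<in> V}"
  proof (rule openin_charts[OF atlas])
    fix c assume c: "c \<in> \<A>"
    let ?U = "chart_map c ` chart_dom c"
    have chart: "is_chart M c" using atlas c by (auto simp: smooth_atlas_def)
    have sub: "chart_dom c \<subseteq> topspace M" using chart by (auto simp: is_chart_def openin_subset)
    have "continuous_on ?U (u \<circ> chart_inv c)"
      by (rule smooth_on_imp_continuous_on) (use u c in \<open>simp add: smooth_function_def smooth_in_chart_def\<close>)
    moreover have "open ?U" using chart by (simp add: is_chart_def)
    ultimately have "open (?U \<inter> (u \<circ> chart_inv c) -` V)"
      using V by (intro continuous_open_preimage) auto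
    from openin_chart_preimage[OF chart this]
    have "openin M {p \<in> chart_dom c. chart_map c p \<in> ?U \<inter> (u \<circ> chart_inv c) -` V}" .
    moreover have "{p \<in> chart_dom c. chart_map c p \<in> ?U \<inter> (u \<circ> chart_inv c) -` V} =
        chart_dom c \<inter> {p \<in> topspace M. u p \<in> V}"
      using is_chart_imp_inj[OF chart] sub by (auto simp: chart_inv_def inj_on_eq_iff)
    ultimately show "openin M (chart_dom c \<inter> {p \<in> topspace M. u p \<in> V})" by simp
  qed auto
qed auto

lemma riemannian_chart_of_atlas:
  assumes "riemannian_manifold M \<A> g" "c \<in> \<A>"
  shows "riemannian_chart c g"
proof
  have chart: "is_chart M c"
    using assms by (auto simp: riemannian_manifold_def smooth_manifold_def smooth_atlas_def)
  then show "inj_on (chart_map c) (chart_dom c)" "open (chart_map c ` chart_dom c)"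
    by (auto simp: is_chart_imp_inj is_chart_def)
qed (use assms in \<open>auto simp: riemannian_manifold_def riemannian_metric_def\<close>)

text \<open>The set where \<open>u\<close> attains its minimum is closed by continuity, open by the strong minimum principle
  in each chart, and nonempty by compactness.\<close>

theorem f_superharmonic_constant:
  assumes space: "smooth_metric_measure_space M \<A> g f"
    and connected: "connected_space M" and closed: "compact_space M"
    and u: "smooth_function \<A> u"
    and super: "\<And>c p. c \<in> \<A> \<Longrightarrow> p \<in> chart_dom c \<Longrightarrow> f_laplacian g f c u p \<le> 0"
  shows "\<exists>m. \<forall>p\<in>topspace M. u p = m"
proof (cases "topspace M = {}")
  case False
  have riem: "riemannian_manifold M \<A> g" and f: "smooth_function \<A> f"
    using space by (auto simp: smooth_metric_measure_space_def)
  then have atlas: "smooth_atlas M \<A>"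
    by (simp add: riemannian_manifold_def smooth_manifold_def)
  have cont: "continuous_map M euclideanreal u"
    by (rule smooth_function_continuous[OF atlas u])
  have "compact (u ` topspace M)"
    using image_compactin[OF closed[unfolded compact_space_def] cont] by simp
  from compact_attains_inf[OF this] False
  obtain p0 where p0: "p0 \<in> topspace M" "\<And>p. p \<in> topspace M \<Longrightarrow> u p0 \<le> u p"
    by auto
  let ?Z = "{p \<in> topspace M. u p = u p0}"
  have "openin M ?Z"
  proof (rule openin_charts[OF atlas])
    fix c assume c: "c \<in> \<A>"
    interpret riemannian_chart c g by (rule riemannian_chart_of_atlas[OF riem c])
    have chart: "is_chart M c" using atlas c by (auto simp: smooth_atlas_def)
    have sub: "chart_dom c \<subseteq> topspace M" using chart by (auto simp: is_chart_def openin_subset)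
    have "open {x \<in> U. (u \<circ> chart_inv c) x = u p0}"
      using u f c super p0(2) sub by (intro minimum_set_open[of f]) (auto simp: smooth_function_def)
    from openin_chart_preimage[OF chart this]
    have "openin M {p \<in> chart_dom c. chart_map c p \<in> {x \<in> U. (u \<circ> chart_inv c) x = u p0}}" .
    moreover have "{p \<in> chart_dom c. chart_map c p \<in> {x \<in> U. (u \<circ> chart_inv c) x = u p0}} = chart_dom c \<inter> ?Z"
      using sub inj_chart by (auto simp: chart_inv_map inj_on_eq_iff)
    ultimately show "openin M (chart_dom c \<inter> ?Z)" by simp
  qed auto
  moreover have "closedin M ?Z"
    using closedin_continuous_map_preimage[OF cont, of "{u p0}"] by simp
  ultimately have "?Z = {} \<or> ?Z = topspace M"
    using connected unfolding connected_space_clopen_in by blast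
  with p0(1) show ?thesis by blast
qed auto

section \<open>The gradient estimate and the Harnack inequality\<close>

lemma (in riemannian_chart) grad_norm_sq_constant:
  assumes "\<And>q. q \<in> chart_dom c \<Longrightarrow> h q = k" and p: "p \<in> chart_dom c"
  shows "grad_norm_sq g c h p = 0"
proof -
  define x where "x = chart_map c p"
  have x: "x \<in> U" and px: "p = chart_inv c x"
    using p by (simp_all add: x_def chart_inv_map)
  have "((\<lambda>_. k) has_derivative (\<lambda>_. 0)) (at x)" by simp
  then have "((h \<circ> chart_inv c) has_derivative (\<lambda>_. 0)) (at x)"
    by (rule has_derivative_transform_within_open[OF _ open_image x]) (simp add: assms(1) chart_inv_in)
  from frechet_derivative_at[OF this, symmetric]
  have "gradient g c h p = 0"
    by (simp add: px vec_eq_iff gradient_eq[OF x] coord_deriv_def)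
  then show ?thesis
    by (simp add: grad_norm_sq_def metric_inner_def)
qed

text \<open>The exponents \<open>\<epsilon>/(1+\<epsilon>)\<close> and \<open>1/(1+\<epsilon>)\<close> add up to \<open>1\<close>, so \<open>m\<close> is the product of its powers to
  these exponents, and \<open>m \<le> eA\<close> bounds the first factor.\<close>

lemma constant_harnack:
  fixes m A \<epsilon> E :: real
  assumes "0 < m" "m \<le> A" "0 < \<epsilon>" "E \<ge> 0"
  shows "m \<le> (exp 1 * A) powr (\<epsilon> / (1 + \<epsilon>)) * exp E * m powr (1 / (1 + \<epsilon>))"
proof -
  have "m \<le> 1 * A" using assms by simp
  also have "\<dots> \<le> exp 1 * A"
    using assms by (intro mult_right_mono) auto
  finally have "m \<le> exp 1 * A" .
  then have "m powr (\<epsilon> / (1 + \<epsilon>)) \<le> (exp 1 * A) powr (\<epsilon> / (1 + \<epsilon>))"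
    using assms by (intro powr_mono2) auto
  also have "\<dots> \<le> (exp 1 * A) powr (\<epsilon> / (1 + \<epsilon>)) * exp E"
    using assms by (simp add: mult_left_le)
  finally have "m powr (\<epsilon> / (1 + \<epsilon>)) * m powr (1 / (1 + \<epsilon>)) \<le>
      (exp 1 * A) powr (\<epsilon> / (1 + \<epsilon>)) * exp E * m powr (1 / (1 + \<epsilon>))"
    by (intro mult_right_mono) auto
  moreover have "\<epsilon> / (1 + \<epsilon>) + 1 / (1 + \<epsilon>) = 1"
    using assms by (simp add: field_simps)
  then have "m powr (\<epsilon> / (1 + \<epsilon>)) * m powr (1 / (1 + \<epsilon>)) = m"
    using assms by (simp flip: powr_add)
  ultimately show ?thesis by simp
qed

theorem theorem2p11:
  fixes M :: "'a topology" and \<A> :: "('a, 'n::finite) chart set" and g :: "('a, 'n) metric"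
    and f u :: "'a \<Rightarrow> real" and \<Sigma> :: "real \<Rightarrow> real" and k A :: real
  assumes space: "smooth_metric_measure_space M \<A> g f"
    and connected: "connected_space M"
    and closed: "compact_space M"
    and complete: "Metric_space.mcomplete (topspace M) (geodesic_dist M \<A> g)"
    and dim: "CARD('n) \<ge> 2"
    and k: "k \<ge> 0"
    and ricci: "generalised_ricci_ge \<A> g f (- k)"
    and \<Sigma>: "\<Sigma> C1_differentiable_on {0<..}"
    and u_smooth: "smooth_function \<A> u"
    and u_bounds: "\<And>p. p \<in> topspace M \<Longrightarrow> 0 < u p \<and> u p \<le> A"
    and u_eq: "\<And>c p. c \<in> \<A> \<Longrightarrow> p \<in> chart_dom c \<Longrightarrow> f_laplacian g f c u p + \<Sigma> (u p) = 0"
    and \<Sigma>_nonneg: "\<And>p. p \<in> topspace M \<Longrightarrow> \<Sigma> (u p) \<ge> 0"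
    and \<Sigma>_deriv: "\<And>p. p \<in> topspace M \<Longrightarrow> \<Sigma> (u p) / u p - 2 * deriv \<Sigma> (u p) \<ge> 0"
  shows "(\<forall>c\<in>\<A>. \<forall>p\<in>chart_dom c.
            grad_norm_sq g c (\<lambda>q. ln (u q)) p \<le> 2 * k * (1 + ln (A / u p))) \<and>
         (\<forall>\<epsilon>>0. \<forall>p\<in>topspace M. \<forall>q\<in>topspace M.
            0 < u p \<and>
            u p \<le> (exp 1 * A) powr (\<epsilon> / (1 + \<epsilon>))
                  * exp (k * (geodesic_dist M \<A> g p q)\<^sup>2 / (2 * \<epsilon>))
                  * u q powr (1 / (1 + \<epsilon>)))"
proof -
  have riem: "riemannian_manifold M \<A> g"
    using space by (simp add: smooth_metric_measure_space_def)
  have sub: "chart_dom c \<subseteq> topspace M" if "c \<in> \<A>" for c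
    using riem that by (auto simp: riemannian_manifold_def smooth_manifold_def smooth_atlas_def)
  have "f_laplacian g f c u p \<le> 0" if "c \<in> \<A>" "p \<in> chart_dom c" for c p
    using u_eq[OF that] \<Sigma>_nonneg[of p] sub that by fastforce
  from f_superharmonic_constant[OF space connected closed u_smooth this]
  obtain m where m: "\<And>p. p \<in> topspace M \<Longrightarrow> u p = m" by blast
  have grad: "grad_norm_sq g c (\<lambda>q. ln (u q)) p \<le> 2 * k * (1 + ln (A / u p))"
    if c: "c \<in> \<A>" and p: "p \<in> chart_dom c" for c p
  proof -
    have "grad_norm_sq g c (\<lambda>q. ln (u q)) p = 0"
      using m sub[OF c] p
      by (intro riemannian_chart.grad_norm_sq_constant[OF riemannian_chart_of_atlas[OF riem c], of _ "ln m"]) auto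
    moreover have "ln (A / u p) \<ge> 0"
      using u_bounds[of p] sub[OF c] p by (intro ln_ge_zero) auto
    ultimately show ?thesis using k by simp
  qed
  have harnack: "0 < u p \<and>
      u p \<le> (exp 1 * A) powr (\<epsilon> / (1 + \<epsilon>)) * exp (k * (geodesic_dist M \<A> g p q)\<^sup>2 / (2 * \<epsilon>))
        * u q powr (1 / (1 + \<epsilon>))"
    if "\<epsilon> > 0" "p \<in> topspace M" "q \<in> topspace M" for \<epsilon> p q
    using constant_harnack[of m A \<epsilon> "k * (geodesic_dist M \<A> g p q)\<^sup>2 / (2 * \<epsilon>)"]
      u_bounds[OF that(2)] that k by (simp add: m)
  from grad harnack show ?thesis by blast
qed

end
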